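(* Let $T$ be a binary tree with $n\ge1$ nodes, let $T_1$ and $T_2$ be its left and right subtrees, and let $T'_2$ be the left subtree of $T_2$. Then $$\mathbf P_T(\mathbb X)=\frac{(q^{\#T_2}-q^{\#T'_2}t)(1-q^{\#T_1}t)}{(1-q^{\#T'_2}t)(1-q^n)}\,\mathbf P_{T_1}(\mathbb X)\,\mathbf P_{T_2}(\mathbb X),$$ where $\#U$ is the number of nodes of $U$, with the conventions that $\mathbf P_\emptyset(\mathbb X)=1$, $\#\emptyset=0$, and $\#T'_2=0$ if $T_2$ is empty.
   Context: For a word $w$ with distinct integer letters, its decreasing binary tree is empty if $w$ is empty, and otherwise has root labelled by the maximal letter $m$, writing $w=w'mw''$, with left subtree the decreasing tree of $w'$ and right subtree that of $w''$. For $\sigma\in\mathfrak S_N$, $P(\sigma)$ is the shape of the decreasing binary tree of $\sigma^{-1}$. For $\mu\in\mathfrak S_N$ and $\epsilon\in\{\pm1\}^N$ let $w=(\epsilon_1\mu_1,\dots,\epsilon_N\mu_N)$, $\mathrm{maj}(\mu,\epsilon)=\sum_{i:\,w_i>w_{i+1}}i$, $m(\epsilon)$ the number of $-1$ entries, $(q)_N=\prod_{i=1}^N(1-q^i)$, and $\mathbf F_\mu(\mathbb X)=\frac1{(q)_N}\sum_{\epsilon}(-t)^{m(\epsilon)}q^{\mathrm{maj}(\mu,\epsilon)}$ ($(q,t)$-specialization at $\mathbb X=\frac1{1-q}\hat\times(1-t)$). Then $\mathbf P_T(\mathbb X)=\sum_{\sigma:\,P(\sigma)=T}\mathbf F_\sigma(\mathbb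 X)$. *)

theory Defs
  imports
    "HOL-Library.Tree"
    "HOL-Library.FuncSet"
    "HOL-Combinatorics.Permutations"
    "HOL-Computational_Algebra.Fraction_Field"
    "HOL-Computational_Algebra.Polynomial"
begin

text \<open>
  Permutations of \<open>{1..N}\<close> are functions \<open>\<sigma>\<close> with \<open>\<sigma> permutes {1..N}\<close>; the one-line word of \<open>\<sigma>\<close> is
  \<open>map \<sigma> [1..<N + 1]\<close>. Unlabelled binary trees are elements of \<open>unit tree\<close>; \<open>size\<close> counts
  (internal) nodes. The library functions \<open>left\<close> and \<open>right\<close> map the empty tree to itself.
\<close>

text \<open>
  With \<open>m\<close> the maximal letter, the word is \<open>w' m w''\<close> where \<open>w'\<close> is the part before the first
  occurrence of \<open>m\<close>; for words with distinct letters this occurrence is the only one.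
\<close>

function decreasing_tree :: "'a::linorder list \<Rightarrow> 'a tree" where
  "decreasing_tree w =
     (if w = [] then Leaf
      else let m = Max (set w) in
        Node (decreasing_tree (takeWhile (\<lambda>x. x \<noteq> m) w))
             m
             (decreasing_tree (tl (dropWhile (\<lambda>x. x \<noteq> m) w))))"
  by auto
termination
proof (relation "measure length", goal_cases)
  case 1
  then show ?case by simp
next
  case (2 w m)
  then have "m \<in> set w" by simp
  then obtain w' w'' where "w = w' @ m # w''" "m \<notin> set w'"
    by (meson split_list_first)
  then show ?case by (simp add: takeWhile_append)
next
  case (3 w m)
  then show ?case
    using length_dropWhile_le[of "\<lambda>x. x \<noteq> m" w] by (cases w) auto
qed

declare decreasing_tree.simps [simp del]

definition shape :: "'a tree \<Rightarrow> unit tree" where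
  "shape t = map_tree (\<lambda>_. ()) t"

definition P_symbol :: "nat \<Rightarrow> (nat \<Rightarrow> nat) \<Rightarrow> unit tree" where
  "P_symbol N \<sigma> = shape (decreasing_tree (map (inv \<sigma>) [1..<N + 1]))"

definition sign_vectors :: "nat \<Rightarrow> (nat \<Rightarrow> int) set" where
  "sign_vectors N = {1..N} \<rightarrow>\<^sub>E {-1, 1}"

definition signed_letter :: "(nat \<Rightarrow> nat) \<Rightarrow> (nat \<Rightarrow> int) \<Rightarrow> nat \<Rightarrow> int" where
  "signed_letter \<mu> \<epsilon> i = \<epsilon> i * int (\<mu> i)"

definition maj :: "nat \<Rightarrow> (nat \<Rightarrow> nat) \<Rightarrow> (nat \<Rightarrow> int) \<Rightarrow> nat" where
  "maj N \<mu> \<epsilon> =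
     (\<Sum>i | 1 \<le> i \<and> i < N \<and> signed_letter \<mu> \<epsilon> i > signed_letter \<mu> \<epsilon> (i + 1). i)"

definition num_neg :: "nat \<Rightarrow> (nat \<Rightarrow> int) \<Rightarrow> nat" where
  "num_neg N \<epsilon> = card {i \<in> {1..N}. \<epsilon> i = -1}"

definition qpoch :: "'a::field \<Rightarrow> nat \<Rightarrow> 'a" where
  "qpoch q N = (\<Prod>i=1..N. 1 - q ^ i)"

definition F_spec :: "'a::field \<Rightarrow> 'a \<Rightarrow> nat \<Rightarrow> (nat \<Rightarrow> nat) \<Rightarrow> 'a" where
  "F_spec q t N \<mu> =
     1 / qpoch q N * (\<Sum>\<epsilon>\<in>sign_vectors N. (- t) ^ num_neg N \<epsilon> * q ^ maj N \<mu> \<epsilon>)"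

text \<open>
  The tree \<open>P_symbol N \<sigma>\<close> has \<open>N\<close> nodes, so only permutations of \<open>{1..size T}\<close> contribute.
\<close>

definition P_spec :: "'a::field \<Rightarrow> 'a \<Rightarrow> unit tree \<Rightarrow> 'a" where
  "P_spec q t T =
     (\<Sum>\<sigma> | \<sigma> permutes {1..size T} \<and> P_symbol (size T) \<sigma> = T. F_spec q t (size T) \<sigma>)"

lemma size_decreasing_tree: "size (decreasing_tree w) = length w"
proof (induction w rule: decreasing_tree.induct)
  case (1 w)
  show ?case
  proof (cases "w = []")
    case True
    then show ?thesis by (simp add: decreasing_tree.simps)
  next
    case False
    define m where "m = Max (set w)"
    have "m \<in> set w" using False by (simp add: m_def)
    then obtain w' w'' where w: "w = w' @ m # w''" "m \<notin> set w'"
      by (meson split_list_first)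
    then have tw: "takeWhile (\<lambda>x. x \<noteq> m) w = w'" "tl (dropWhile (\<lambda>x. x \<noteq> m) w) = w''"
      by (auto simp: takeWhile_append dropWhile_append)
    have "size (decreasing_tree w') = length w'" "size (decreasing_tree w'') = length w''"
      using 1[OF False m_def] tw by auto
    moreover have "decreasing_tree w = Node (decreasing_tree w') m (decreasing_tree w'')"
      using False tw by (subst decreasing_tree.simps) (simp add: Let_def flip: m_def)
    ultimately show ?thesis using w by simp
  qed
qed

lemma size_P_symbol: "size (P_symbol N \<sigma>) = N"
  by (simp add: P_symbol_def shape_def size_decreasing_tree)

lemma P_spec_Leaf: "P_spec q t Leaf = 1"
proof -
  have "{\<sigma>::nat \<Rightarrow> nat. \<sigma> permutes {1..0} \<and> P_symbol 0 \<sigma> = Leaf} = {id}"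
    by (auto simp: P_symbol_def shape_def decreasing_tree.simps)
  then show ?thesis
    by (simp add: P_spec_def F_spec_def qpoch_def sign_vectors_def num_neg_def maj_def)
qed

text \<open>
  The parameters \<open>q\<close> and \<open>t\<close> may be taken in any field in which the relevant denominators do not
  vanish. Two independent indeterminates over a field satisfy these conditions, so identities
  between rational functions in \<open>q\<close> and \<open>t\<close> are a special case.
\<close>

lemma indeterminates_nonvanishing:
  fixes q t :: "'k::field poly poly fract"
  defines "q \<equiv> Fraction_Field.Fract [:[:0, 1:]:] 1" and "t \<equiv> Fraction_Field.Fract [:0, 1:] 1"
  shows "i \<ge> 1 \<Longrightarrow> q ^ i \<noteq> 1" and "q ^ k * t \<noteq> 1"
proof -
  have pow: "q ^ j = Fraction_Field.Fract ([:monom 1 j:]) 1" for j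
    by (induction j)
      (simp_all add: q_def One_fract_def monom_Suc mult_monom flip: one_pCons monom_0)
  show "q ^ i \<noteq> 1" if "i \<ge> 1"
  proof
    assume "q ^ i = 1"
    then have "[:monom (1::'k) i:] = 1"
      by (simp add: pow One_fract_def eq_fract)
    then have "monom (1::'k) i = 1"
      by (metis one_pCons pCons_eq_iff)
    then have "degree (monom (1::'k) i) = 0" by simp
    then show False using that by (simp add: degree_monom_eq)
  qed
  show "q ^ k * t \<noteq> 1"
    by (simp add: pow t_def One_fract_def eq_fract one_pCons)
qed

end

theory Submission
  imports Defs
begin

text \<open>
  Read a permutation word backwards. Then \<open>P(\<sigma>)\<close> is the binary search tree obtained by inserting
  the letters one after the other: the first letter \<open>v\<close> is the root, and the remaining letters
  form an arbitrary shuffle of a word with tree \<open>T\<^sub>1\<close> on the letters below \<open>v\<close> and a word with tree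
  \<open>T\<^sub>2\<close> on the letters above \<open>v\<close>. The sum of \<open>q\<^bsup>maj\<^esup>\<close> over all shuffles of two
  disjoint words behind a fixed first letter factors, with the \<open>q\<close>-binomial coefficient as
  constant. A signed first letter \<open>\<plusminus>v\<close> compares with the smaller letters according to its own sign
  and with the larger letters as \<open>0\<close> would. Hence the generating function \<open>A\<close> of the signed words
  of a tree, divided by \<open>(q)\<^sub>n\<close>, and its variant \<open>C\<close>, in which \<open>0\<close> is put in front of every word, satisfy
  \<open>A(T) = (1 - q\<^bsup>#T\<^sub>1\<^esup> t) / (1 - q\<^sup>n) A(T\<^sub>1) C(T\<^sub>2)\<close> and
  \<open>C(T) = (q\<^sup>n - q\<^bsup>#T\<^sub>1\<^esup> t) / (1 - q\<^sup>n) A(T\<^sub>1) C(T\<^sub>2)\<close>;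
  their quotient expresses \<open>C(T\<^sub>2)\<close> through \<open>A(T\<^sub>2)\<close>.
\<close>

text \<open>The major index of the reversed word: a descent at position \<open>i\<close> of the original word is an
  ascent of the reversed word with \<open>i\<close> letters behind it.\<close>

fun rmaj :: "'a::linorder list \<Rightarrow> nat" where
  "rmaj [] = 0"
| "rmaj [x] = 0"
| "rmaj (x # y # ys) = (if x < y then Suc (length ys) else 0) + rmaj (y # ys)"

section \<open>Binary search trees and decreasing trees\<close>

text \<open>The key \<open>k\<close> avoids relabelling: signed words are inserted by absolute
  value, positions of a permutation by their images. Letters tying with the root are dropped, so the
  size is controlled only for distinct keys.\<close>

function insertion_tree :: "('a \<Rightarrow> 'b::linorder) \<Rightarrow> 'a list \<Rightarrow> unit tree" where
  "insertion_tree k [] = Leaf"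
| "insertion_tree k (x # xs) =
     Node (insertion_tree k (filter (\<lambda>y. k y < k x) xs)) ()
       (insertion_tree k (filter (\<lambda>y. k x < k y) xs))"
  by pat_completeness auto
termination
  by (relation "measure (length \<circ> snd)") (auto simp: less_Suc_eq_le)

lemma insertion_tree_map: "insertion_tree k (map g xs) = insertion_tree (k \<circ> g) xs"
  by (induction "k \<circ> g" xs rule: insertion_tree.induct) (simp_all add: filter_map comp_def)

lemma insertion_tree_cong:
  "(\<And>x. x \<in> set xs \<Longrightarrow> k x = k' x) \<Longrightarrow> insertion_tree k xs = insertion_tree k' xs"
proof (induction k xs rule: insertion_tree.induct)
  case (2 k x xs)
  have "filter (\<lambda>y. k y < k x) xs = filter (\<lambda>y. k' y < k' x) xs"
       "filter (\<lambda>y. k x < k y) xs = filter (\<lambda>y. k' x < k' y) xs"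
    using 2(3) by (auto intro!: filter_cong)
  then show ?case using 2 by simp
qed simp

lemma size_insertion_tree: "distinct (map k xs) \<Longrightarrow> size (insertion_tree k xs) = length xs"
proof (induction k xs rule: insertion_tree.induct)
  case (2 k x xs)
  have "filter (\<lambda>y. k x < k y) xs = filter (\<lambda>y. \<not> k y < k x) xs"
    using 2(3) by (intro filter_cong) (auto simp: not_less order_le_less)
  then show ?case
    using 2 sum_length_filter_compl[of "\<lambda>y. k y < k x" xs] by (simp add: distinct_map_filter)
qed simp

text \<open>Since \<open>v\<close> lists its keys by decreasing \<open>f\<close>, its head carries
  the maximum of \<open>f\<close> and labels the root. Cutting the sorted list \<open>S\<close>
  there separates smaller keys from larger ones, exactly as insertion does.\<close>

lemma shape_decreasing_tree_eq_insertion_tree: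
  assumes "sorted_wrt (\<lambda>x y. f (k y) < f (k x)) v"
    and "sorted_wrt (<) S" and "set S = k ` set v"
  shows "shape (decreasing_tree (map f S)) = insertion_tree k v"
  using assms
proof (induction k v arbitrary: S rule: insertion_tree.induct)
  case (1 k)
  then show ?case by (simp add: shape_def decreasing_tree.simps)
next
  case (2 k x xs)
  have lt: "f (k y) < f (k x)" if "y \<in> set xs" for y
    using 2(3) that by simp
  obtain S1 S2 where S: "S = S1 @ k x # S2"
    using 2(5) by (metis image_eqI list.set_intros(1) split_list)
  have S12: "\<forall>z\<in>set S1. z < k x" "\<forall>z\<in>set S2. k x < z" "sorted_wrt (<) S1" "sorted_wrt (<) S2"
    using 2(4) by (auto simp: S sorted_wrt_append)
  have "set S1 = {z \<in> set S. z < k x}" and "set S2 = {z \<in> set S. k x < z}"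
    using S12(1,2) by (auto simp: S)
  moreover have "{z \<in> set S. z < k x} = k ` set (filter (\<lambda>y. k y < k x) xs)"
    and "{z \<in> set S. k x < z} = k ` set (filter (\<lambda>y. k x < k y) xs)"
    unfolding 2(5) by auto
  ultimately have S1: "set S1 = k ` set (filter (\<lambda>y. k y < k x) xs)"
    and S2: "set S2 = k ` set (filter (\<lambda>y. k x < k y) xs)"
    by simp_all
  have "Max (set (map f S)) = f (k x)"
    using lt unfolding list.set_map 2(5) by (intro Max_eqI) (auto intro: less_imp_le)
  \<comment> \<open>This makes the cut of the word at its first maximum fall exactly behind
    \<open>S1\<close>.\<close>
  moreover have "\<forall>z\<in>set S1. f z \<noteq> f (k x)"
    using S1 lt by fastforce
  ultimately have "decreasing_tree (map f S) =
      Node (decreasing_tree (map f S1)) (f (k x)) (decreasing_tree (map f S2))"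
    by (subst decreasing_tree.simps) (simp add: S Let_def takeWhile_append dropWhile_append)
  moreover have "shape (decreasing_tree (map f S1)) = insertion_tree k (filter (\<lambda>y. k y < k x) xs)"
    using 2(3) by (intro 2(1) S12(3) S1 sorted_wrt_filter) simp
  moreover have "shape (decreasing_tree (map f S2)) = insertion_tree k (filter (\<lambda>y. k x < k y) xs)"
    using 2(3) by (intro 2(2) S12(4) S2 sorted_wrt_filter) simp
  ultimately show ?case by (simp add: shape_def)
qed

section \<open>Shuffles of words and q-Pochhammer products\<close>

lemma qpoch_Suc: "qpoch q (Suc n) = qpoch q n * (1 - q ^ Suc n)"
  by (simp add: qpoch_def)

lemma qpoch_eq_0_iff: "qpoch q n = 0 \<longleftrightarrow> (\<exists>i\<in>{1..n}. q ^ i = 1)"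
  by (auto simp: qpoch_def)

lemma rmaj_Cons: "rmaj (x # u) = (if u \<noteq> [] \<and> x < hd u then length u else 0) + rmaj u"
  by (cases u) auto

lemma sum_shuffles_Cons:
  assumes "x \<noteq> y"
  shows "(\<Sum>u\<in>shuffles (x # xs) (y # ys). f u) =
    (\<Sum>u\<in>shuffles xs (y # ys). f (x # u)) + (\<Sum>u\<in>shuffles (x # xs) ys. f (y # u))"
  using assms by (subst shuffles.simps, subst sum.union_disjoint) (auto simp: sum.reindex)

text \<open>Induction on the first letter of the shuffle. The two \<open>q\<close>-Pascal rules correspond to the relative
  orders of \<open>x\<close> and the two leading letters.\<close>

lemma sum_shuffles_rmaj:
  fixes q :: "'a::field" and x :: "'b::linorder"
  assumes "set a \<inter> set b = {}"
  shows "qpoch q (length a) * qpoch q (length b) * (\<Sum>u\<in>shuffles a b. q ^ rmaj (x # u)) =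
    qpoch q (length a + length b) * q ^ (rmaj (x # a) + rmaj (x # b))"
  using assms
proof (induction a b arbitrary: x rule: shuffles.induct)
  case (1 ys)
  then show ?case by (simp add: qpoch_def)
next
  case (2 xs)
  then show ?case by (simp add: qpoch_def)
next
  case (3 c xs d ys)
  define m k where "m = Suc (length xs)" and "k = Suc (length ys)"
  \<comment> \<open>\<open>X\<close> and \<open>Y\<close> are the contributions of \<open>x\<close>
    in front of the separate words; \<open>X'\<close> and \<open>Y'\<close> are those in front of a
    shuffle, which always has \<open>m + k\<close> letters.\<close>
  define X where "X = (if x < c then q ^ m else 1)"
  define Y where "Y = (if x < d then q ^ k else 1)"
  define X' where "X' = (if x < c then q ^ (m + k) else 1)"
  define Y' where "Y' = (if x < d then q ^ (m + k) else 1)"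
  define E where "E = q ^ (rmaj (c # xs) + rmaj (d # ys))"
  have cd: "c \<noteq> d" using 3(3) by auto
  \<comment> \<open>The leading letter \<open>c\<close> of the shuffle takes over the role of
    \<open>x\<close>, hence the generalization over \<open>x\<close>.\<close>
  have IH1: "qpoch q (length xs) * qpoch q k * (\<Sum>u\<in>shuffles xs (d # ys). q ^ rmaj (c # u)) =
      qpoch q (length xs + k) * (if c < d then q ^ k else 1) * E"
    using 3(1)[of c] 3(3) by (simp add: k_def E_def power_add mult_ac)
  have IH2: "qpoch q m * qpoch q (length ys) * (\<Sum>u\<in>shuffles (c # xs) ys. q ^ rmaj (d # u)) =
      qpoch q (m + length ys) * (if d < c then q ^ m else 1) * E"
    using 3(2)[of d] 3(3) by (simp add: m_def E_def power_add mult_ac)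
  have len1: "length u = length xs + k" if "u \<in> shuffles xs (d # ys)" for u
    using length_shuffles[OF that] by (simp add: k_def)
  have len2: "length u = m + length ys" if "u \<in> shuffles (c # xs) ys" for u
    using length_shuffles[OF that] by (simp add: m_def)
  have S1: "(\<Sum>u\<in>shuffles xs (d # ys). q ^ rmaj (x # c # u)) =
      X' * (\<Sum>u\<in>shuffles xs (d # ys). q ^ rmaj (c # u))"
    unfolding sum_distrib_left
    by (intro sum.cong) (auto simp: X'_def len1 m_def power_add)
  have S2: "(\<Sum>u\<in>shuffles (c # xs) ys. q ^ rmaj (x # d # u)) =
      Y' * (\<Sum>u\<in>shuffles (c # xs) ys. q ^ rmaj (d # u))"
    unfolding sum_distrib_left
    by (intro sum.cong) (auto simp: Y'_def len2 k_def power_add)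
  have R: "q ^ (rmaj (x # c # xs) + rmaj (x # d # ys)) = X * Y * E"
    by (simp add: X_def Y_def E_def m_def k_def power_add)
  \<comment> \<open>For either order of \<open>c\<close> and \<open>d\<close> there remain three
    positions of \<open>x\<close> relative to them; each gives a q-Pascal rule.\<close>
  have key: "(1 - q ^ m) * X' * (if c < d then q ^ k else 1) +
      (1 - q ^ k) * Y' * (if d < c then q ^ m else 1) = (1 - q ^ (m + k)) * (X * Y)"
    using cd by (auto simp: X_def Y_def X'_def Y'_def power_add algebra_simps)
  define Q where "Q = qpoch q (length xs + k)"
  have Q: "qpoch q (m + length ys) = Q" "qpoch q (m + k) = Q * (1 - q ^ (m + k))"
    by (simp_all add: Q_def m_def k_def qpoch_Suc)
  have "qpoch q m * qpoch q k * (\<Sum>u\<in>shuffles (c # xs) (d # ys). q ^ rmaj (x # u)) =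
     (1 - q ^ m) * X' *
       (qpoch q (length xs) * qpoch q k * (\<Sum>u\<in>shuffles xs (d # ys). q ^ rmaj (c # u))) +
     (1 - q ^ k) * Y' *
       (qpoch q m * qpoch q (length ys) * (\<Sum>u\<in>shuffles (c # xs) ys. q ^ rmaj (d # u)))"
    unfolding sum_shuffles_Cons[OF cd] S1 S2
    by (simp add: m_def k_def qpoch_Suc algebra_simps)
  also have "\<dots> = Q * E * ((1 - q ^ m) * X' * (if c < d then q ^ k else 1) +
      (1 - q ^ k) * Y' * (if d < c then q ^ m else 1))"
    unfolding IH1 IH2 Q(1) Q_def[symmetric] by (simp only: algebra_simps)
  also have "\<dots> = qpoch q (m + k) * (X * Y * E)"
    unfolding key Q(2) by (simp only: algebra_simps)
  finally show ?case
    unfolding R by (simp add: m_def k_def)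
qed

section \<open>Signed words with a given insertion tree\<close>

text \<open>The offset \<open>lo\<close> is there for the recursion: the letters of a right subtree
  start above the root letter.\<close>

definition signed_words :: "unit tree \<Rightarrow> nat \<Rightarrow> int list set" where
  "signed_words T lo = {u. distinct (map (\<lambda>y. nat \<bar>y\<bar>) u) \<and>
     (\<lambda>y. nat \<bar>y\<bar>) ` set u = {lo<..lo + size T} \<and> insertion_tree (\<lambda>y. nat \<bar>y\<bar>) u = T}"

lemma length_signed_words: "u \<in> signed_words T lo \<Longrightarrow> length u = size T"
  by (auto simp: signed_words_def size_insertion_tree)

lemma abs_signed_words:
  "u \<in> signed_words T lo \<Longrightarrow> y \<in> set u \<Longrightarrow> lo < nat \<bar>y\<bar> \<and> nat \<bar>y\<bar> \<le> lo + size T"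
  unfolding signed_words_def by (metis (mono_tags, lifting) greaterThanAtMost_iff imageI mem_Collect_eq)

lemma finite_signed_words [simp]: "finite (signed_words T lo)"
proof (rule finite_subset)
  let ?S = "{- int (lo + size T)..int (lo + size T)}"
  show "signed_words T lo \<subseteq> {u. set u \<subseteq> ?S \<and> length u = size T}"
    using abs_signed_words[of _ T lo] length_signed_words[of _ T lo] by fastforce
  show "finite {u. set u \<subseteq> ?S \<and> length u = size T}"
    by (rule finite_lists_length_eq) simp
qed

lemma signed_words_Leaf [simp]: "signed_words Leaf lo = {[]}"
  by (auto simp: signed_words_def)

text \<open>The left subtree uses up the \<open>size l\<close> smallest absolute values, so the tree
  alone fixes the absolute value of the first letter, and only its sign stays free.\<close>

lemma Cons_in_signed_words_iff:
  fixes y :: int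
  defines "x \<equiv> nat \<bar>y\<bar>"
  shows "y # u \<in> signed_words (Node l c r) lo \<longleftrightarrow>
    x = Suc (lo + size l) \<and> x \<notin> (\<lambda>y. nat \<bar>y\<bar>) ` set u \<and>
    filter (\<lambda>y. nat \<bar>y\<bar> < x) u \<in> signed_words l lo \<and>
    filter (\<lambda>y. x < nat \<bar>y\<bar>) u \<in> signed_words r x" (is "?L \<longleftrightarrow> ?R")
proof
  let ?k = "\<lambda>y::int. nat \<bar>y\<bar>"
  let ?l = "filter (\<lambda>y. ?k y < x) u" and ?r = "filter (\<lambda>y. x < ?k y) u"
  assume L: ?L
  then have dist: "distinct (map ?k u)" and x: "x \<notin> ?k ` set u"
    and set: "insert x (?k ` set u) = {lo<..lo + size (Node l c r)}"
    and trees: "insertion_tree ?k ?l = l" "insertion_tree ?k ?r = r"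
    by (auto simp: signed_words_def x_def)
  have xlo: "lo < x" "x \<le> lo + size (Node l c r)"
    using set by (metis greaterThanAtMost_iff insertI1)+
  have u: "?k ` set u = {lo<..lo + size (Node l c r)} - {x}"
    using set x by blast
  have setl: "?k ` set ?l = {lo<..<x}"
  proof -
    have "?k ` set ?l = {z \<in> ?k ` set u. z < x}" by auto
    also have "\<dots> = {lo<..<x}" unfolding u using xlo by auto
    finally show ?thesis .
  qed
  have setr: "?k ` set ?r = {x<..lo + size (Node l c r)}"
  proof -
    have "?k ` set ?r = {z \<in> ?k ` set u. x < z}" by auto
    also have "\<dots> = {x<..lo + size (Node l c r)}" unfolding u using xlo by auto
    finally show ?thesis .
  qed
  have distl: "distinct (map ?k ?l)" and distr: "distinct (map ?k ?r)"
    using dist by (simp_all add: distinct_map_filter)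
  have "size l = card (?k ` set ?l)"
    using size_insertion_tree[OF distl] distinct_card[OF distl] trees by simp
  then have xeq: "x = Suc (lo + size l)"
    using xlo unfolding setl by simp
  have "{lo<..<x} = {lo<..lo + size l}" by (auto simp: xeq)
  moreover have "lo + size (Node l c r) = x + size r" by (simp add: xeq)
  ultimately show ?R
    using xeq x trees distl distr setl setr by (simp add: signed_words_def add.assoc)
next
  let ?k = "\<lambda>y::int. nat \<bar>y\<bar>"
  let ?l = "filter (\<lambda>y. ?k y < x) u" and ?r = "filter (\<lambda>y. x < ?k y) u"
  assume R: ?R
  then have x: "x = Suc (lo + size l)" "x \<notin> ?k ` set u" and l: "?l \<in> signed_words l lo"
    and r: "?r \<in> signed_words r x" by auto
  have nl: "?r = filter (\<lambda>y. \<not> ?k y < x) u"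
    using x(2) by (intro filter_cong) (auto simp: not_less order_le_less)
  have len: "length u = size l + size r"
    using length_signed_words[OF l] length_signed_words[OF r] nl
      sum_length_filter_compl[of "\<lambda>y. ?k y < x" u] by simp
  have "set u = set ?l \<union> set ?r" using nl by auto
  then have "?k ` set u = ?k ` set ?l \<union> ?k ` set ?r" by (metis image_Un)
  also have "\<dots> = {lo<..lo + size l} \<union> {x<..x + size r}"
    using l r unfolding signed_words_def by blast
  finally have set: "?k ` set u = {lo<..lo + size l} \<union> {x<..x + size r}" .
  \<comment> \<open>There are as many absolute values as letters, which forces them to be
    distinct.\<close>
  have "card (?k ` set u) = size l + size r"
    unfolding set by (subst card_Un_disjoint) (auto simp: x(1))
  then have "distinct (map ?k u)"
    using len by (intro card_distinct) simp
  moreover have "insert x (?k ` set u) = {lo<..lo + size (Node l c r)}"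
    unfolding set by (auto simp: x(1))
  moreover have "insertion_tree ?k ?l = l" "insertion_tree ?k ?r = r"
    using l r by (auto simp: signed_words_def)
  ultimately show ?L
    using x(2) by (auto simp: signed_words_def x_def)
qed

lemma filter_shuffles_signed_words:
  assumes a: "a \<in> signed_words l lo" and b: "b \<in> signed_words r (Suc (lo + size l))"
    and u: "u \<in> shuffles a b"
  shows "filter (\<lambda>y. nat \<bar>y\<bar> < Suc (lo + size l)) u = a" (is "filter ?P u = a")
    and "filter (\<lambda>y. Suc (lo + size l) < nat \<bar>y\<bar>) u = b" (is "filter ?Q u = b")
proof -
  have "filter ?P a = a" "filter ?Q a = []"
    using abs_signed_words[OF a] by (force simp: filter_id_conv filter_empty_conv)+
  moreover have "filter ?P b = []" "filter ?Q b = b"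
    using abs_signed_words[OF b] by (force simp: filter_id_conv filter_empty_conv)+
  ultimately show "filter ?P u = a" "filter ?Q u = b"
    using imageI[OF u, of "filter ?P"] imageI[OF u, of "filter ?Q"]
    unfolding filter_shuffles by auto
qed

text \<open>A signed word amounts to the sign of its root letter, its two subwords and the way they
  are shuffled. Filtering by absolute value undoes the shuffle.\<close>

lemma sum_signed_words_Node:
  "(\<Sum>w\<in>signed_words (Node l c r) lo. f w) =
    (\<Sum>s\<in>{1, -1}. \<Sum>a\<in>signed_words l lo. \<Sum>b\<in>signed_words r (Suc (lo + size l)).
      \<Sum>u\<in>shuffles a b. f (s * int (Suc (lo + size l)) # u))"
proof -
  define x where "x = Suc (lo + size l)"
  let ?k = "\<lambda>y::int. nat \<bar>y\<bar>"
  let ?l = "filter (\<lambda>y. ?k y < x)" and ?r = "filter (\<lambda>y. x < ?k y)"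
  let ?S = "SIGMA s:{1, -1 :: int}. SIGMA a:signed_words l lo. SIGMA b:signed_words r x. shuffles a b"
  have "(\<Sum>w\<in>signed_words (Node l c r) lo. f w) = (\<Sum>(s, a, b, u)\<in>?S. f (s * int x # u))"
  proof (rule sum.reindex_bij_witness[where
        j = "\<lambda>w. (sgn (hd w), ?l (tl w), ?r (tl w), tl w)" and
        i = "\<lambda>(s, a, b, u). s * int x # u"])
    fix w assume w: "w \<in> signed_words (Node l c r) lo"
    then obtain y u where yu: "w = y # u" by (cases w) (auto simp: signed_words_def)
    have kx: "?k y = x"
      using w unfolding yu Cons_in_signed_words_iff x_def by (rule conjunct1)
    have *: "?k y = x" "x \<notin> ?k ` set u" "?l u \<in> signed_words l lo" "?r u \<in> signed_words r x"
      using w kx unfolding yu Cons_in_signed_words_iff kx by blast+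
    have y: "sgn y * int x = y" using *(1) by (auto simp: sgn_if x_def split: if_splits)
    show "(case (sgn (hd w), ?l (tl w), ?r (tl w), tl w) of (s, a, b, u) \<Rightarrow> s * int x # u) = w"
      using y by (simp add: yu)
    have "?r u = filter (\<lambda>y. \<not> ?k y < x) u"
      using *(2) by (intro filter_cong) (auto simp: not_less order_le_less)
    then have "u \<in> shuffles (?l u) (?r u)"
      using partition_in_shuffles[of u "\<lambda>y. ?k y < x"] by simp
    moreover have "sgn y \<in> {1, -1}" using *(1) by (auto simp: sgn_if x_def)
    ultimately show "(sgn (hd w), ?l (tl w), ?r (tl w), tl w) \<in> ?S"
      using * by (simp add: yu)
    show "(case (sgn (hd w), ?l (tl w), ?r (tl w), tl w) of (s, a, b, u) \<Rightarrow> f (s * int x # u)) = f w"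
      using y by (simp add: yu)
  next
    fix p assume "p \<in> ?S"
    then obtain s a b u where p: "p = (s, a, b, u)" "s \<in> {1, -1}" and a: "a \<in> signed_words l lo"
      and b: "b \<in> signed_words r x" and u: "u \<in> shuffles a b" by auto
    have lr: "?l u = a" "?r u = b"
      using filter_shuffles_signed_words[OF a _ u] b by (auto simp: x_def)
    have s: "sgn (s * int x) = s" "?k (s * int x) = x"
      using p(2) by (auto simp: x_def sgn_mult)
    have "x \<notin> ?k ` set u"
      using abs_signed_words[OF a] abs_signed_words[OF b] set_shuffles[OF u] by (force simp: x_def)
    then have "s * int x # u \<in> signed_words (Node l c r) lo"
      unfolding Cons_in_signed_words_iff s(2) using lr a b by (simp add: x_def)
    then show "(case p of (s, a, b, u) \<Rightarrow> s * int x # u) \<in> signed_words (Node l c r) lo"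
      by (simp add: p)
    show "(\<lambda>w. (sgn (hd w), ?l (tl w), ?r (tl w), tl w)) (case p of (s, a, b, u) \<Rightarrow> s * int x # u) = p"
      using lr s by (simp add: p)
  qed
  also have "\<dots> = (\<Sum>s\<in>{1, -1}. \<Sum>a\<in>signed_words l lo. \<Sum>b\<in>signed_words r x.
      \<Sum>u\<in>shuffles a b. f (s * int x # u))"
    by (simp add: sum.Sigma finite_SigmaI del: sum.insert)
  finally show ?thesis by (simp only: x_def)
qed

section \<open>Generating functions and their recursion\<close>

definition neg_weight :: "'a::field \<Rightarrow> int list \<Rightarrow> 'a" where
  "neg_weight t u = (- t) ^ length (filter (\<lambda>y. y < 0) u)"

lemma neg_weight_shuffles:
  assumes "u \<in> shuffles a b"
  shows "neg_weight t u = neg_weight t a * neg_weight t b"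
proof -
  have "filter (\<lambda>y. y < 0) u \<in> shuffles (filter (\<lambda>y. y < 0) a) (filter (\<lambda>y. y < 0) b)"
    using imageI[OF assms, of "filter (\<lambda>y. y < 0)"] unfolding filter_shuffles .
  from length_shuffles[OF this] show ?thesis
    by (simp add: neg_weight_def power_add)
qed

text \<open>\<open>word_sum\<close> is \<open>A\<close> and \<open>word_sum0\<close> is \<open>C\<close>, on the letters \<open>lo + 1, \<dots>, lo + size T\<close>.\<close>

definition word_sum :: "'a::field \<Rightarrow> 'a \<Rightarrow> unit tree \<Rightarrow> nat \<Rightarrow> 'a" where
  "word_sum q t T lo =
     (\<Sum>u\<in>signed_words T lo. neg_weight t u * q ^ rmaj u) / qpoch q (size T)"

definition word_sum0 :: "'a::field \<Rightarrow> 'a \<Rightarrow> unit tree \<Rightarrow> nat \<Rightarrow> 'a" where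
  "word_sum0 q t T lo =
     (\<Sum>u\<in>signed_words T lo. neg_weight t u * q ^ rmaj (0 # u)) / qpoch q (size T)"

text \<open>The root letter forms an ascent with the head of \<open>a\<close> iff
  \<open>s = -1\<close>, and with the head of \<open>b\<close> iff \<open>0\<close> does. The
  shuffle identity then decouples the sums over \<open>a\<close> and \<open>b\<close>.\<close>

lemma sum_signed_words_root:
  fixes q t :: "'a::field" and s :: int and lo :: nat and l r :: "unit tree"
  assumes q: "\<forall>i\<in>{1..size l + size r}. q ^ i \<noteq> 1" and s: "s \<in> {1, -1}"
  defines "x \<equiv> Suc (lo + size l)"
  shows "(\<Sum>a\<in>signed_words l lo. \<Sum>b\<in>signed_words r x. \<Sum>u\<in>shuffles a b.
      neg_weight t (s * int x # u) * q ^ rmaj (s * int x # u)) / qpoch q (size l + size r) =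
    (if s = 1 then 1 else - t * q ^ size l) * word_sum q t l lo * word_sum0 q t r x"
proof -
  define c where "c = (if s = 1 then 1 else - t * q ^ size l)"
  have nz: "qpoch q (size l) \<noteq> 0" "qpoch q (size r) \<noteq> 0" "qpoch q (size l + size r) \<noteq> 0"
    using q by (auto simp: qpoch_eq_0_iff)
  have "(\<Sum>u\<in>shuffles a b. neg_weight t (s * int x # u) * q ^ rmaj (s * int x # u)) =
      qpoch q (size l + size r) * c * (neg_weight t a * q ^ rmaj a / qpoch q (size l)) *
        (neg_weight t b * q ^ rmaj (0 # b) / qpoch q (size r))"
    if a: "a \<in> signed_words l lo" and b: "b \<in> signed_words r x" for a b
  proof -
    have la: "length a = size l" and lb: "length b = size r"
      using length_signed_words a b by auto
    have disj: "set a \<inter> set b = {}"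
      using abs_signed_words[OF a] abs_signed_words[OF b] by (force simp: x_def)
    have sa: "a \<noteq> [] \<Longrightarrow> s * int x < hd a \<longleftrightarrow> s = -1"
      using abs_signed_words[OF a, of "hd a"] s by (auto simp: x_def)
    have sb: "b \<noteq> [] \<Longrightarrow> s * int x < hd b \<longleftrightarrow> 0 < hd b"
      using abs_signed_words[OF b, of "hd b"] s by (auto simp: x_def)
    have ra: "rmaj (s * int x # a) = (if s = 1 then 0 else size l) + rmaj a"
      using sa s la by (cases "a = []") (auto simp: rmaj_Cons)
    have rb: "rmaj (s * int x # b) = rmaj (0 # b)"
      using sb by (cases "b = []") (auto simp: rmaj_Cons)
    have sh: "(\<Sum>u\<in>shuffles a b. q ^ rmaj (s * int x # u)) = qpoch q (size l + size r) *
        q ^ (rmaj (s * int x # a) + rmaj (s * int x # b)) / (qpoch q (size l) * qpoch q (size r))"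
      using sum_shuffles_rmaj[OF disj, of q "s * int x"] nz by (simp add: la lb field_simps)
    have w: "neg_weight t (s * int x # u) = (if s = 1 then 1 else - t) * neg_weight t a * neg_weight t b"
      if "u \<in> shuffles a b" for u
      using neg_weight_shuffles[OF that, of t] s by (auto simp: neg_weight_def x_def)
    have "(\<Sum>u\<in>shuffles a b. neg_weight t (s * int x # u) * q ^ rmaj (s * int x # u)) =
        (if s = 1 then 1 else - t) * neg_weight t a * neg_weight t b *
        (\<Sum>u\<in>shuffles a b. q ^ rmaj (s * int x # u))"
      unfolding sum_distrib_left by (intro sum.cong) (simp_all only: w)
    also have "\<dots> = qpoch q (size l + size r) * c * (neg_weight t a * q ^ rmaj a / qpoch q (size l)) *
        (neg_weight t b * q ^ rmaj (0 # b) / qpoch q (size r))"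
      unfolding sh ra rb c_def by (simp add: power_add)
    finally show ?thesis .
  qed
  then have "(\<Sum>a\<in>signed_words l lo. \<Sum>b\<in>signed_words r x. \<Sum>u\<in>shuffles a b.
      neg_weight t (s * int x # u) * q ^ rmaj (s * int x # u)) =
    qpoch q (size l + size r) * c * word_sum q t l lo * word_sum0 q t r x"
    unfolding word_sum_def word_sum0_def
    by (simp add: sum_distrib_left sum_distrib_right sum_divide_distrib mult_ac)
  then show ?thesis using nz by (simp add: c_def)
qed

lemma word_sum_Node:
  fixes q t :: "'a::field"
  assumes "\<forall>i\<in>{1..size (Node l c r)}. q ^ i \<noteq> 1"
  shows "word_sum q t (Node l c r) lo = (1 - q ^ size l * t) / (1 - q ^ size (Node l c r)) *
      word_sum q t l lo * word_sum0 q t r (Suc (lo + size l))" (is ?A)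
    and "word_sum0 q t (Node l c r) lo =
      (q ^ size (Node l c r) - q ^ size l * t) / (1 - q ^ size (Node l c r)) *
      word_sum q t l lo * word_sum0 q t r (Suc (lo + size l))" (is ?C)
proof -
  define x where "x = Suc (lo + size l)"
  define n where "n = size (Node l c r)"
  define I where "I s = (\<Sum>a\<in>signed_words l lo. \<Sum>b\<in>signed_words r x. \<Sum>u\<in>shuffles a b.
      neg_weight t (s * int x # u) * q ^ rmaj (s * int x # u))" for s
  have I: "I s = qpoch q (size l + size r) *
     ((if s = 1 then 1 else - t * q ^ size l) * word_sum q t l lo * word_sum0 q t r x)"
    if "s \<in> {1, -1}" for s
  proof -
    have q: "\<forall>i\<in>{1..size l + size r}. q ^ i \<noteq> 1" using assms by auto
    then have "qpoch q (size l + size r) \<noteq> 0" by (auto simp: qpoch_eq_0_iff)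
    then show ?thesis
      using sum_signed_words_root[OF q that, of t lo] by (simp add: I_def x_def field_simps)
  qed
  have qp: "qpoch q n = qpoch q (size l + size r) * (1 - q ^ n)"
    by (simp add: n_def qpoch_Suc)
  have nz: "qpoch q n \<noteq> 0" using assms by (auto simp: qpoch_eq_0_iff n_def)
  have A: "word_sum q t (Node l c r) lo = (I 1 + I (-1)) / qpoch q n"
    unfolding word_sum_def sum_signed_words_Node I_def x_def n_def by simp
  \<comment> \<open>A leading \<open>0\<close> adds an ascent with all \<open>n\<close> letters
    behind it, precisely when the root letter is positive.\<close>
  have "(\<Sum>a\<in>signed_words l lo. \<Sum>b\<in>signed_words r x. \<Sum>u\<in>shuffles a b.
      neg_weight t (s * int x # u) * q ^ rmaj (0 # s * int x # u)) =
     (if s = 1 then q ^ n else 1) * I s" if "s \<in> {1, -1}" for s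
    unfolding I_def sum_distrib_left
  proof (intro sum.cong refl)
    fix a b u assume a: "a \<in> signed_words l lo" and b: "b \<in> signed_words r x"
      and u: "u \<in> shuffles a b"
    have "length u = size l + size r"
      using length_shuffles[OF u] length_signed_words[OF a] length_signed_words[OF b] by simp
    then show "neg_weight t (s * int x # u) * q ^ rmaj (0 # s * int x # u) =
      (if s = 1 then q ^ n else 1) * (neg_weight t (s * int x # u) * q ^ rmaj (s * int x # u))"
      using that by (auto simp: x_def n_def power_add)
  qed
  then have C: "word_sum0 q t (Node l c r) lo = (q ^ n * I 1 + I (-1)) / qpoch q n"
    unfolding word_sum0_def sum_signed_words_Node x_def n_def by (simp del: of_nat_Suc)
  show ?A ?C
    using nz unfolding A C qp n_def[symmetric] x_def[symmetric]
    by (simp_all add: I field_simps)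
qed

text \<open>The coefficients of the recursion depend only on sizes, so the offset disappears by
  induction. This lets the right subtree be compared with \<open>P_spec\<close>, where the offset is
  \<open>0\<close>.\<close>

lemma word_sum_shift:
  fixes q t :: "'a::field"
  assumes "\<forall>i\<in>{1..size T}. q ^ i \<noteq> 1"
  shows "word_sum q t T lo = word_sum q t T lo'" and "word_sum0 q t T lo = word_sum0 q t T lo'"
  using assms
proof (induction T arbitrary: lo lo')
  case Leaf
  {
    case 1 show ?case by (simp add: word_sum_def)
  next
    case 2 show ?case by (simp add: word_sum0_def)
  }
next
  case (Node l c r)
  {
    case 1
    then show ?case
      using Node(1)[of lo lo'] Node(4)[of "Suc (lo + size l)" "Suc (lo' + size l)"]
      by (simp add: word_sum_Node)
  next
    case 2
    then show ?case
      using Node(1)[of lo lo'] Node(4)[of "Suc (lo + size l)" "Suc (lo' + size l)"]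
      by (simp add: word_sum_Node)
  }
qed

text \<open>Both recursions share the factors of the subtrees and differ only in the coefficient.
  For the empty tree the ratio is \<open>(1 - t) / (1 - t)\<close>, as
  \<open>left Leaf = Leaf\<close>.\<close>

lemma word_sum0_eq:
  fixes q t :: "'a::field"
  assumes "\<forall>i\<in>{1..size T}. q ^ i \<noteq> 1" and "q ^ size (left T) * t \<noteq> 1"
  shows "word_sum0 q t T lo =
    (q ^ size T - q ^ size (left T) * t) / (1 - q ^ size (left T) * t) * word_sum q t T lo"
proof (cases T)
  case Leaf
  then show ?thesis using assms(2) by (simp add: word_sum_def word_sum0_def qpoch_def)
next
  case (Node l c r)
  then show ?thesis using assms by (simp add: word_sum_Node)
qed

section \<open>From permutations with signs to signed words\<close>

lemma sum_descents_eq_rmaj: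
  "(\<Sum>i | 1 \<le> i \<and> i < N \<and> w i > w (i + 1). i) = rmaj (rev (map w [1..<N + 1]))"
proof (induction N)
  case (Suc N)
  show ?case
  proof (cases "N = 0")
    case False
    then obtain M where M: "N = Suc M" by (cases N) auto
    \<comment> \<open>The only new position is \<open>N\<close>, which becomes the leading pair of
      the reversed word.\<close>
    have "{i. 1 \<le> i \<and> i < Suc N \<and> w i > w (i + 1)} =
        (if w N > w (N + 1) then {N} else {}) \<union> {i. 1 \<le> i \<and> i < N \<and> w i > w (i + 1)}"
      using False by (auto simp: less_Suc_eq)
    then show ?thesis using Suc by (simp add: M)
  qed (auto intro: sum.neutral)
qed simp

text \<open>Take \<open>f = inv \<sigma>\<close> and \<open>k = \<sigma>\<close>: reading positions
  from \<open>N\<close> down to \<open>1\<close> visits the letters by decreasing value of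
  \<open>inv \<sigma>\<close>.\<close>

lemma P_symbol_eq_insertion_tree:
  assumes "\<sigma> permutes {1..N}"
  shows "P_symbol N \<sigma> = insertion_tree \<sigma> (rev [1..<N + 1])"
  unfolding P_symbol_def
proof (rule shape_decreasing_tree_eq_insertion_tree)
  show "sorted_wrt (\<lambda>x y. inv \<sigma> (\<sigma> y) < inv \<sigma> (\<sigma> x)) (rev [1..<N + 1])"
    using permutes_inverses(2)[OF assms] by (simp add: sorted_wrt_rev del: upt_Suc)
  have "set [1..<N + 1] = {1..N}" by auto
  then show "set [1..<N + 1] = \<sigma> ` set (rev [1..<N + 1])"
    using permutes_image[OF assms] by simp
qed (rule sorted_wrt_upt)

text \<open>Reversing the signed word is a bijection; absolute values recover the permutation and
  signs recover the sign vector.\<close>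

lemma P_spec_eq_word_sum: "P_spec q t T = word_sum q t T 0"
proof -
  note upt_Suc [simp del]
  define N where "N = size T"
  let ?k = "\<lambda>y::int. nat \<bar>y\<bar>"
  let ?S = "{\<sigma>. \<sigma> permutes {1..N} \<and> P_symbol N \<sigma> = T} \<times> sign_vectors N"
  let ?i = "\<lambda>(\<sigma>, \<epsilon>). rev (map (signed_letter \<sigma> \<epsilon>) [1..<N + 1])"
  \<comment> \<open>Position \<open>i\<close> sits at index \<open>N - i\<close> of the reversed
    list, counted from \<open>0\<close>. Outside \<open>{1..N}\<close> the values are those required
    by \<open>permutes\<close> and by the extensional function space.\<close>
  let ?j1 = "\<lambda>u i. if i \<in> {1..N} then ?k (u ! (N - i)) else i"
  let ?j2 = "\<lambda>u. restrict (\<lambda>i. sgn (u ! (N - i))) {1..N}"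
  have absl: "?k (signed_letter \<sigma> \<epsilon> i) = \<sigma> i" if "\<epsilon> \<in> sign_vectors N" "i \<in> {1..N}" for \<sigma> \<epsilon> i
  proof -
    have "\<epsilon> i \<in> {-1, 1}" using that by (auto simp: sign_vectors_def)
    then show ?thesis by (auto simp: signed_letter_def)
  qed
  have ran: "set [1..<N + 1] = {1..N}" by auto
  have "(\<Sum>(\<sigma>, \<epsilon>)\<in>?S. (- t) ^ num_neg N \<epsilon> * q ^ maj N \<sigma> \<epsilon>) =
    (\<Sum>u\<in>signed_words T 0. neg_weight t u * q ^ rmaj u)"
  proof (rule sum.reindex_bij_witness[where j = ?i and i = "\<lambda>u. (?j1 u, ?j2 u)"])
    fix p assume "p \<in> ?S"
    then obtain \<sigma> \<epsilon> where p: "p = (\<sigma>, \<epsilon>)" and \<sigma>: "\<sigma> permutes {1..N}" and P: "P_symbol N \<sigma> = T"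
      and \<epsilon>: "\<epsilon> \<in> sign_vectors N" by auto
    let ?w = "signed_letter \<sigma> \<epsilon>"
    define u where "u = ?i p"
    have u: "u = rev (map ?w [1..<N + 1])" by (simp add: u_def p)
    have nth: "u ! (N - i) = ?w i" if "i \<in> {1..N}" for i
      using that by (auto simp: u rev_nth)
    have pos: "\<sigma> i \<ge> 1" if "i \<in> {1..N}" for i
      using permutes_in_image[OF \<sigma>, of i] that by simp
    have ei: "\<epsilon> i \<in> {-1, 1}" if "i \<in> {1..N}" for i
      using \<epsilon> that by (auto simp: sign_vectors_def)
    have sgnw: "sgn (?w i) = \<epsilon> i" if "i \<in> {1..N}" for i
      using pos[OF that] ei[OF that] by (auto simp: signed_letter_def)
    have "?j1 u = \<sigma>"
    proof
      fix i show "?j1 u i = \<sigma> i"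
        using nth[of i] absl[OF \<epsilon>, of i \<sigma>] permutes_not_in[OF \<sigma>, of i] by auto
    qed
    moreover have "?j2 u = \<epsilon>"
    proof
      fix i show "?j2 u i = \<epsilon> i"
        using nth[of i] sgnw[of i] \<epsilon> by (auto simp: sign_vectors_def)
    qed
    ultimately show "(?j1 (?i p), ?j2 (?i p)) = p"
      unfolding u_def[symmetric] unfolding p by (simp only:)
    have mapk: "map ?k u = rev (map \<sigma> [1..<N + 1])"
      unfolding u rev_map[symmetric] map_map using absl[OF \<epsilon>] ran by auto
    have "distinct (map ?k u)"
      unfolding mapk using permutes_inj_on[OF \<sigma>] by (simp add: distinct_map)
    moreover have "?k ` set u = {0<..0 + size T}"
    proof -
      have "?k ` set u = set (map ?k u)" by simp
      also have "\<dots> = {1..N}" unfolding mapk using permutes_image[OF \<sigma>] ran by simp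
      finally show ?thesis by (auto simp: N_def)
    qed
    moreover have "insertion_tree ?k u = T"
    proof -
      have "insertion_tree ?k u = insertion_tree (?k \<circ> ?w) (rev [1..<N + 1])"
        unfolding u rev_map insertion_tree_map ..
      also have "\<dots> = insertion_tree \<sigma> (rev [1..<N + 1])"
        using absl[OF \<epsilon>] by (intro insertion_tree_cong) auto
      finally show ?thesis using P P_symbol_eq_insertion_tree[OF \<sigma>] by simp
    qed
    ultimately show "?i p \<in> signed_words T 0"
      unfolding u_def[symmetric] by (simp add: signed_words_def)
    have "rmaj u = maj N \<sigma> \<epsilon>"
      unfolding maj_def u sum_descents_eq_rmaj ..
    moreover have "length (filter (\<lambda>y. y < 0) u) = num_neg N \<epsilon>"
    proof -
      have "length (filter (\<lambda>y. y < 0) u) = length (filter (\<lambda>i. ?w i < 0) [1..<N + 1])"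
        unfolding u by (simp add: rev_filter[symmetric] filter_map comp_def)
      also have "\<dots> = card {i \<in> {1..N}. ?w i < 0}"
        by (subst distinct_card[symmetric]) (auto intro!: arg_cong[where f = card])
      also have "{i \<in> {1..N}. ?w i < 0} = {i \<in> {1..N}. \<epsilon> i = -1}"
        using pos ei by (fastforce simp: signed_letter_def)
      finally show ?thesis by (simp add: num_neg_def)
    qed
    ultimately show "neg_weight t (?i p) * q ^ rmaj (?i p) =
        (case p of (\<sigma>, \<epsilon>) \<Rightarrow> (- t) ^ num_neg N \<epsilon> * q ^ maj N \<sigma> \<epsilon>)"
      unfolding u_def[symmetric] unfolding p by (simp add: neg_weight_def)
  next
    fix u assume uT: "u \<in> signed_words T 0"
    have len: "length u = N" using length_signed_words[OF uT] by (simp add: N_def)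
    have nthu: "u ! (N - i) \<in> set u" if "i \<in> {1..N}" for i
      using that len by auto
    have nz: "u ! (N - i) \<noteq> 0" if "i \<in> {1..N}" for i
      using abs_signed_words[OF uT nthu[OF that]] by auto
    have \<epsilon>: "?j2 u \<in> sign_vectors N"
      using nz by (auto simp: sign_vectors_def sgn_if)
    have "signed_letter (?j1 u) (?j2 u) i = u ! (N - i)" if "i \<in> {1..N}" for i
      using that by (simp add: signed_letter_def sgn_mult_abs)
    then have "map (signed_letter (?j1 u) (?j2 u)) [1..<N + 1] = rev u"
      by (intro nth_equalityI) (auto simp: len rev_nth)
    then show iu: "?i (?j1 u, ?j2 u) = u" by simp
    have dist: "distinct (map ?k u)" and tree: "insertion_tree ?k u = T"
      using uT by (auto simp: signed_words_def)
    have img: "?j1 u i \<in> {1..N}" if "i \<in> {1..N}" for i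
      using abs_signed_words[OF uT nthu[OF that]] that by (auto simp: N_def)
    have inj: "inj_on (?j1 u) {1..N}"
    proof (rule inj_onI)
      fix i j assume ij: "i \<in> {1..N}" "j \<in> {1..N}" "?j1 u i = ?j1 u j"
      then have "map ?k u ! (N - i) = map ?k u ! (N - j)" by (simp add: len)
      then have "N - i = N - j" using dist ij by (subst (asm) nth_eq_iff_index_eq) (auto simp: len)
      then show "i = j" using ij by auto
    qed
    \<comment> \<open>An injective map of a finite set into itself is onto.\<close>
    have "?j1 u ` {1..N} = {1..N}"
      by (rule card_subset_eq) (use img card_image[OF inj] in blast)+
    then have "bij_betw (?j1 u) {1..N} {1..N}" using inj by (simp add: bij_betw_def)
    then have perm: "?j1 u permutes {1..N}" by (rule bij_imp_permutes) auto
    have "P_symbol N (?j1 u) = insertion_tree (?j1 u) (rev [1..<N + 1])"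
      by (rule P_symbol_eq_insertion_tree[OF perm])
    also have "\<dots> = insertion_tree (?k \<circ> signed_letter (?j1 u) (?j2 u)) (rev [1..<N + 1])"
      using absl[OF \<epsilon>, of _ "?j1 u"] by (intro insertion_tree_cong) auto
    also have "\<dots> = insertion_tree ?k (?i (?j1 u, ?j2 u))"
      unfolding insertion_tree_map[symmetric] by (simp add: rev_map)
    also have "\<dots> = T" unfolding iu by (rule tree)
    finally show "(?j1 u, ?j2 u) \<in> ?S" using perm \<epsilon> by blast
  qed
  then show ?thesis
    unfolding P_spec_def F_spec_def word_sum_def N_def[symmetric]
    by (simp add: sum.cartesian_product[symmetric] sum_divide_distrib[symmetric])
qed

theorem theorem5p5:
  fixes q t :: "'a::field"
    and T T1 T2 T2' :: "unit tree"
    and n :: nat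
  assumes "size T = n" and "n \<ge> 1"
    and "T1 = left T" and "T2 = right T" and "T2' = left T2"
    and "\<forall>i\<in>{1..n}. q ^ i \<noteq> 1"
    and "q ^ size T2' * t \<noteq> 1"
  shows "P_spec q t T =
           ((q ^ size T2 - q ^ size T2' * t) * (1 - q ^ size T1 * t)) /
           ((1 - q ^ size T2' * t) * (1 - q ^ n)) * P_spec q t T1 * P_spec q t T2"
proof -
  obtain c where T: "T = Node T1 c T2"
    using assms(1-4) by (cases T) auto
  have q: "\<forall>i\<in>{1..size (Node T1 c T2)}. q ^ i \<noteq> 1" and q2: "\<forall>i\<in>{1..size T2}. q ^ i \<noteq> 1"
    using assms(1,6) by (auto simp: T)
  have "P_spec q t T = (1 - q ^ size T1 * t) / (1 - q ^ n) *
      P_spec q t T1 * word_sum0 q t T2 (Suc (size T1))"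
    using word_sum_Node(1)[OF q, of t 0] assms(1) by (simp add: P_spec_eq_word_sum T flip: power_Suc)
  \<comment> \<open>The ratio turns the variant with leading \<open>0\<close> into the plain sum,
    whose offset is then shifted to \<open>0\<close>.\<close>
  also have "word_sum0 q t T2 (Suc (size T1)) =
      (q ^ size T2 - q ^ size T2' * t) / (1 - q ^ size T2' * t) * P_spec q t T2"
    using word_sum0_eq[OF q2, of t] word_sum_shift(1)[OF q2] assms(5,7)
    by (simp add: P_spec_eq_word_sum)
  finally show ?thesis by (simp add: mult_ac)
qed

end
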